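(* Let $R$ be an associative ring (not necessarily unital) and let $a,b,c\in R$. Then $a$ has at most one annihilator $(b,c)$-inverse in $R$.
   Context: For $u\in R$ write ${}^{\circ}u=\{r\in R: ru=0\}$ (left annihilator) and $u^{\circ}=\{r\in R: ur=0\}$ (right annihilator). An element $x\in R$ is an annihilator $(b,c)$-inverse of $a$ if $xax=x$, $xab=b$, $cax=c$, ${}^{\circ}b\subseteq{}^{\circ}x$, and $c^{\circ}\subseteq x^{\circ}$. *)

theory Defs
  imports Main
begin

(* Class ring is that of associative rings; neither a unit nor commutativity is assumed. *)

definition left_annihilator :: "'a::ring \<Rightarrow> 'a set" where
  "left_annihilator u = {r. r * u = 0}"

definition right_annihilator :: "'a::ring \<Rightarrow> 'a set" where
  "right_annihilator u = {r. u * r = 0}"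

definition is_annihilator_inverse :: "'a::ring \<Rightarrow> 'a \<Rightarrow> 'a \<Rightarrow> 'a \<Rightarrow> bool" where
  "is_annihilator_inverse a b c x \<longleftrightarrow>
     x * a * x = x \<and> x * a * b = b \<and> c * a * x = c \<and>
     left_annihilator b \<subseteq> left_annihilator x \<and>
     right_annihilator c \<subseteq> right_annihilator x"

end

theory Submission
  imports Defs
begin

text \<open>
  If \<open>b\<close> has its left annihilator contained in that of \<open>x\<close>, then applying the inclusion to a
  difference \<open>r - s\<close> turns \<open>r b = s b\<close> into \<open>r x = s x\<close>; dually on the right. If \<open>x\<close> and \<open>y\<close> are annihilator
  \<open>(b, c)\<close>-inverses of \<open>a\<close>, then \<open>x a b = b = y a b\<close>, so \<open>x a\<close> and \<open>y a\<close> agree on \<open>b\<close> and hence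
  on \<open>x\<close>; this gives \<open>x = x a x = y a x\<close>. Dually \<open>c a x = c = c a y\<close> gives \<open>y a x = y a y = y\<close>.
  The product \<open>y a x\<close> thus equals both inverses.
\<close>

lemma left_annihilator_subset_cancel:
  assumes "left_annihilator b \<subseteq> left_annihilator x" and "r * b = s * b"
  shows "r * x = s * x"
proof -
  have "r - s \<in> left_annihilator b"
    using assms(2) by (simp add: left_annihilator_def left_diff_distrib)
  with assms(1) have "r - s \<in> left_annihilator x" ..
  then show ?thesis by (simp add: left_annihilator_def left_diff_distrib)
qed

lemma right_annihilator_subset_cancel:
  assumes "right_annihilator c \<subseteq> right_annihilator x" and "c * r = c * s"
  shows "x * r = x * s"
proof -
  have "r - s \<in> right_annihilator c"
    using assms(2) by (simp add: right_annihilator_def right_diff_distrib)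
  with assms(1) have "r - s \<in> right_annihilator x" ..
  then show ?thesis by (simp add: right_annihilator_def right_diff_distrib)
qed

theorem theorem2p1:
  fixes a b c :: "'a::ring"
  shows "\<exists>\<^sub>\<le>\<^sub>1 x. is_annihilator_inverse a b c x"
proof (rule Uniq_I)
  fix x y
  assume x: "is_annihilator_inverse a b c x" and y: "is_annihilator_inverse a b c y"
  have "x = x * a * x"
    using x by (simp add: is_annihilator_inverse_def)
  also have "\<dots> = y * a * x"
    by (rule left_annihilator_subset_cancel[of b])
      (use x y in \<open>simp_all add: is_annihilator_inverse_def\<close>)
  also have "\<dots> = y * (a * x)"
    by (rule mult.assoc)
  also have "\<dots> = y * (a * y)"
    by (rule right_annihilator_subset_cancel[of c])
      (use x y in \<open>simp_all add: is_annihilator_inverse_def flip: mult.assoc\<close>)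
  also have "\<dots> = y"
    using y by (simp add: is_annihilator_inverse_def flip: mult.assoc)
  finally show "y = x" ..
qed

end
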